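(* Let $n\geq 1$ be an integer and let $a,b,c,d$ be nonnegative integers with $0\leq b,d\leq n-1$. If $n$ is odd, then $$D_q(an+b,cn+d)\equiv D(a,c)\,D_q(b,d)\pmod{\Phi_n(q)},$$ and if $n$ is even, then $$D_q(an+b,cn+d)\equiv D_q(b,d)\pmod{\Phi_n(q)},$$ where the congruences are in the polynomial ring $\mathbb{Z}[q]$.
   Context: $\Phi_n(q)$ denotes the $n$-th cyclotomic polynomial. The $q$-integer is $[m]_q=(1-q^m)/(1-q)$ and the $q$-binomial coefficient is $\left[{h\atop k}\right]_q=\frac{[h]_q[h-1]_q\cdots[h-k+1]_q}{[k]_q[k-1]_q\cdots[1]_q}$, with $\left[{h\atop 0}\right]_q=1$ and $\left[{h\atop k}\right]_q=0$ for $k<0$. For nonnegative integers $h,k$ the $q$-Delannoy number is $D_q(h,k)=\sum_{j=0}^{h}q^{\binom{j+1}{2}}\left[{k\atop j}\right]_q\left[{h+k-j\atop k}\right]_q$. $D(a,c)$ is the classical Delannoy number, i.e. the number of lattice paths from $(0,0)$ to $(a,c)$ using only the steps $(1,0)$, $(0,1)$, $(1,1)$; equivalently $D(a,c)=\sum_{j\ge 0}2^j\binom{a}{j}\binom{c}{j}$. *)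

theory Defs
  imports Complex_Main "HOL-Computational_Algebra.Computational_Algebra"
begin

section \<open>Cyclotomic polynomials\<close>

definition primitive_roots :: "nat \<Rightarrow> complex set" where
  "primitive_roots n = {z. z ^ n = 1 \<and> (\<forall>m. 0 < m \<and> m < n \<longrightarrow> z ^ m \<noteq> 1)}"

text \<open>
  The polynomial with integer coefficients whose image over the complex numbers is the monic
  polynomial with simple roots at the primitive \<open>n\<close>-th roots of unity. Existence and uniqueness
  for \<open>n > 0\<close> is lemma \<open>cyclotomic_poly_spec\<close> below.
\<close>
definition cyclotomic_poly :: "nat \<Rightarrow> int poly" where
  "cyclotomic_poly n = (THE p. map_poly of_int p = (\<Prod>z\<in>primitive_roots n. [:- z, 1:]))"

lemma of_int_poly_mult:
  "map_poly (of_int :: int \<Rightarrow> complex) (p * q) = map_poly of_int p * map_poly of_int q"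
  by (rule poly_eqI) (simp add: coeff_map_poly coeff_mult)

lemma of_int_poly_add:
  "map_poly (of_int :: int \<Rightarrow> complex) (p + q) = map_poly of_int p + map_poly of_int q"
  by (rule poly_eqI) (simp add: coeff_map_poly)

lemma of_int_poly_diff:
  "map_poly (of_int :: int \<Rightarrow> complex) (p - q) = map_poly of_int p - map_poly of_int q"
  by (rule poly_eqI) (simp add: coeff_map_poly)

lemma of_int_poly_prod:
  "map_poly (of_int :: int \<Rightarrow> complex) (\<Prod>x\<in>A. f x) = (\<Prod>x\<in>A. map_poly of_int (f x))"
  by (induction A rule: infinite_finite_induct) (simp_all add: of_int_poly_mult)

lemma of_int_poly_inj:
  "map_poly (of_int :: int \<Rightarrow> complex) p = map_poly of_int q \<Longrightarrow> p = q"
  by (rule poly_eqI) (metis coeff_map_poly of_int_0 of_int_eq_iff)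

lemma of_int_poly_degree:
  "degree (map_poly (of_int :: int \<Rightarrow> complex) p) = degree p"
  by (rule degree_map_poly) simp

lemma lead_coeff_prod_linear:
  "lead_coeff (\<Prod>z\<in>A. [:- z, 1 :: complex:]) = 1"
  by (induction A rule: infinite_finite_induct) (simp_all add: lead_coeff_mult del: mult_pCons_left)

lemma degree_prod_linear:
  "finite A \<Longrightarrow> degree (\<Prod>z\<in>A. [:- z, 1 :: complex:]) = card A"
  by (subst degree_prod_eq_sum_degree) auto

lemma roots_unity_factorization:
  assumes "n > 0"
  shows "(\<Prod>z | z ^ n = 1. [:- z, 1 :: complex:]) = monom 1 n - 1" (is "?R = ?L")
proof (rule ccontr)
  let ?A = "{z :: complex. z ^ n = 1}"
  define p where "p = ?L - ?R"
  assume "?R \<noteq> ?L"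
  then have p0: "p \<noteq> 0" by (auto simp: p_def)
  have fin: "finite ?A" using assms by (intro finite_roots_unity) simp
  have crd: "card ?A = n" using assms by (rule card_roots_unity_eq)
  have dR: "degree ?R = n" using degree_prod_linear[OF fin] crd by simp
  have lR: "coeff ?R n = 1" using lead_coeff_prod_linear[of ?A] dR by simp
  have dL: "degree ?L \<le> n" by (rule degree_diff_le) (auto simp: degree_monom_le)
  have lL: "coeff ?L n = 1" using assms by simp
  have "degree p \<le> n" unfolding p_def by (rule degree_diff_le[OF dL]) (use dR in simp)
  moreover have "coeff p n = 0" unfolding p_def using lL lR by simp
  ultimately have "degree p < n"
    using p0 by (metis leading_coeff_0_iff le_neq_implies_less)
  moreover have "?A \<subseteq> {z. poly p z = 0}"
    using fin by (auto simp: p_def poly_monom poly_prod prod_zero_iff)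
  then have "n \<le> card {z. poly p z = 0}"
    using crd card_mono[OF poly_roots_finite[OF p0]] by metis
  moreover have "card {z. poly p z = 0} \<le> degree p" by (rule card_poly_roots_bound[OF p0])
  ultimately show False by simp
qed

lemma primitive_roots_disjoint:
  assumes "d > 0" "e > 0" "d \<noteq> e"
  shows "primitive_roots d \<inter> primitive_roots e = {}"
  using assms by (auto simp: primitive_roots_def) (metis linorder_neqE_nat)

lemma roots_unity_eq_Union_primitive_roots:
  assumes "n > 0"
  shows "{z :: complex. z ^ n = 1} = (\<Union>d\<in>{d. d dvd n}. primitive_roots d)"
proof (intro equalityI subsetI)
  fix z :: complex assume "z \<in> {z. z ^ n = 1}"
  then have z: "z ^ n = 1" by simp
  define d where "d = (LEAST m. 0 < m \<and> z ^ m = 1)"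
  have d: "0 < d \<and> z ^ d = 1" unfolding d_def by (rule LeastI[of _ n]) (use z assms in simp)
  have min: "z ^ m \<noteq> 1" if "0 < m" "m < d" for m
    using not_less_Least[of m "\<lambda>m. 0 < m \<and> z ^ m = 1"] that by (auto simp: d_def)
  have "z ^ n = (z ^ d) ^ (n div d) * z ^ (n mod d)"
    by (simp flip: power_mult power_add)
  then have "z ^ (n mod d) = 1" using z d by simp
  then have "n mod d = 0" using min[of "n mod d"] d by auto
  then have "d dvd n" by auto
  moreover have "z \<in> primitive_roots d" using d min by (auto simp: primitive_roots_def)
  ultimately show "z \<in> (\<Union>d\<in>{d. d dvd n}. primitive_roots d)" by auto
qed (auto simp: primitive_roots_def power_mult elim!: dvdE)

lemma finite_primitive_roots: "n > 0 \<Longrightarrow> finite (primitive_roots n)"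
  by (rule finite_subset[of _ "{z. z ^ n = 1}"])
     (auto simp: primitive_roots_def intro!: finite_roots_unity)

lemma prod_primitive_roots_dvd:
  assumes "n > 0"
  shows "(\<Prod>d | d dvd n. \<Prod>z\<in>primitive_roots d. [:- z, 1 :: complex:]) = monom 1 n - 1"
proof -
  have pos: "d > 0" if "d dvd n" for d using that assms by (auto intro: Nat.gr0I)
  have "(\<Prod>z\<in>(\<Union>d\<in>{d. d dvd n}. primitive_roots d). [:- z, 1 :: complex:])
      = (\<Prod>d | d dvd n. \<Prod>z\<in>primitive_roots d. [:- z, 1:])"
  proof (rule prod.UNION_disjoint)
    show "finite {d. d dvd n}" using assms by simp
    show "\<forall>d\<in>{d. d dvd n}. finite (primitive_roots d)"
      using pos finite_primitive_roots by blast
    show "\<forall>d\<in>{d. d dvd n}. \<forall>e\<in>{d. d dvd n}. d \<noteq> e \<longrightarrow> primitive_roots d \<inter> primitive_roots e = {}"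
      using pos primitive_roots_disjoint by blast
  qed
  then show ?thesis
    using roots_unity_factorization[OF assms] roots_unity_eq_Union_primitive_roots[OF assms] by simp
qed

lemma cyclotomic_poly_exists:
  "n > 0 \<Longrightarrow> \<exists>p :: int poly. map_poly of_int p = (\<Prod>z\<in>primitive_roots n. [:- z, 1:])"
proof (induction n rule: less_induct)
  case (less n)
  define C where "C d = (\<Prod>z\<in>primitive_roots d. [:- z, 1 :: complex:])" for d
  define D where "D = {d. d dvd n} - {n}"
  have finD: "finite {d. d dvd n}" using less.prems by simp
  have "\<exists>p. map_poly of_int p = C d" if "d \<in> D" for d
  proof -
    have "d > 0" "d < n"
      using that less.prems dvd_imp_le[of d n] by (auto simp: D_def intro: Nat.gr0I)
    then show ?thesis using less.IH unfolding C_def by blast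
  qed
  then obtain P where P: "\<And>d. d \<in> D \<Longrightarrow> map_poly of_int (P d) = C d" by metis
  define Q where "Q = (\<Prod>d\<in>D. P d)"
  have Q: "map_poly of_int Q = (\<Prod>d\<in>D. C d)" by (simp add: Q_def of_int_poly_prod P)
  have "lead_coeff (\<Prod>d\<in>D. C d) = 1"
    by (simp add: lead_coeff_prod C_def lead_coeff_prod_linear)
  then have "of_int (lead_coeff Q) = (1 :: complex)"
    by (simp flip: Q add: of_int_poly_degree coeff_map_poly)
  then have lc: "lead_coeff Q = 1" by simp
  then have Q0: "Q \<noteq> 0" by auto
  obtain S R where SR: "pseudo_divmod (monom 1 n - 1) Q = (S, R)" by fastforce
  have eq: "monom 1 n - 1 = Q * S + R" and dR: "R = 0 \<or> degree R < degree Q"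
    using pseudo_divmod[OF Q0 SR] lc by auto
  have "map_poly of_int (monom 1 n - 1 :: int poly) = (monom 1 n - 1 :: complex poly)"
    by (simp add: of_int_poly_diff map_poly_monom)
  also have "\<dots> = (\<Prod>d | d dvd n. C d)"
    using prod_primitive_roots_dvd[OF less.prems] by (simp add: C_def)
  also have "\<dots> = C n * map_poly of_int Q"
    unfolding Q D_def by (rule prod.remove[OF finD]) simp
  finally have "map_poly of_int Q * map_poly of_int S + map_poly of_int R = C n * map_poly of_int Q"
    by (simp add: eq of_int_poly_add of_int_poly_mult)
  then have R: "map_poly of_int R = map_poly of_int Q * (C n - map_poly of_int S)"
    by (simp add: algebra_simps)
  have "C n - map_poly of_int S = 0"
  proof (rule ccontr)
    assume nz: "C n - map_poly of_int S \<noteq> 0"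
    have Q0': "map_poly (of_int :: int \<Rightarrow> complex) Q \<noteq> 0"
      using Q0 of_int_poly_inj[of Q 0] by auto
    have "degree R = degree Q + degree (C n - map_poly of_int S)"
      using arg_cong[OF R, of degree] degree_mult_eq[OF Q0' nz] by (simp add: of_int_poly_degree)
    moreover have "R \<noteq> 0" using R nz Q0' by auto
    ultimately show False using dR by simp
  qed
  then show ?case by (auto simp: C_def)
qed

lemma cyclotomic_poly_spec:
  assumes "n > 0"
  shows "map_poly of_int (cyclotomic_poly n) = (\<Prod>z\<in>primitive_roots n. [:- z, 1:])"
  unfolding cyclotomic_poly_def
  by (rule theI') (use cyclotomic_poly_exists[OF assms] of_int_poly_inj in metis)


section \<open>\<open>q\<close>-integers, \<open>q\<close>-binomial coefficients and \<open>q\<close>-Delannoy numbers\<close>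

text \<open>
  Everything is a polynomial in the indeterminate \<open>q\<close> over the integers. Both divisions below are
  exact (lemmas \<open>q_int_mult\<close> and \<open>q_binom_mult\<close>). The natural subtraction in \<open>q_binom\<close> truncates
  only for \<open>k > h\<close>, when the numerator already has the factor \<open>[0] = 0\<close>.
\<close>

definition qX :: "int poly" where "qX = [:0, 1:]"

definition q_int :: "nat \<Rightarrow> int poly" where
  "q_int m = (1 - qX ^ m) div (1 - qX)"

definition q_binom :: "nat \<Rightarrow> nat \<Rightarrow> int poly" where
  "q_binom h k = (\<Prod>i<k. q_int (h - i)) div (\<Prod>i=1..k. q_int i)"

definition q_delannoy :: "nat \<Rightarrow> nat \<Rightarrow> int poly" where
  "q_delannoy h k = (\<Sum>j=0..h. qX ^ (Suc j choose 2) * q_binom k j * q_binom (h + k - j) k)"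

lemma one_minus_qX_nonzero: "1 - qX \<noteq> 0"
  by (simp add: qX_def one_pCons)

lemma q_int_eq_sum: "q_int m = (\<Sum>i<m. qX ^ i)"
  unfolding q_int_def one_diff_power_eq using one_minus_qX_nonzero by simp

lemma q_int_mult: "(1 - qX) * q_int m = 1 - qX ^ m"
  by (simp add: q_int_eq_sum one_diff_power_eq)

lemma q_int_nonzero:
  assumes "m > 0" shows "q_int m \<noteq> 0"
proof
  assume "q_int m = 0"
  then have "poly (1 - qX ^ m) 0 = 0" using q_int_mult[of m] by (metis mult_zero_right poly_0)
  then show False using assms by (simp add: qX_def power_0_left)
qed

lemma q_int_add: "q_int (m + n) = q_int m + qX ^ m * q_int n"
proof -
  have "(1 - qX) * q_int (m + n) = (1 - qX) * (q_int m + qX ^ m * q_int n)"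
    unfolding distrib_left mult.left_commute[of "1 - qX"] q_int_mult
    by (simp add: algebra_simps power_add)
  then show ?thesis using one_minus_qX_nonzero by simp
qed

lemma q_binom_dvd: "(\<Prod>i=1..k. q_int i) dvd (\<Prod>i<k. q_int (h - i))"
proof (induction h arbitrary: k)
  case 0
  show ?case by (cases k) (auto simp: q_int_eq_sum prod.lessThan_Suc_shift)
next
  case (Suc h)
  show ?case
  proof (cases k)
    case (Suc l)
    have sh: "(\<Prod>i<k. q_int (Suc h - i)) = q_int (Suc h) * (\<Prod>i<l. q_int (h - i))"
      unfolding Suc by (simp add: prod.lessThan_Suc_shift del: prod.lessThan_Suc)
    show ?thesis
    proof (cases "l \<le> h")
      case True
      have "q_int (Suc h) = q_int (Suc l) + qX ^ Suc l * q_int (h - l)"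
        using q_int_add[of "Suc l" "h - l"] True by simp
      then have "(\<Prod>i<k. q_int (Suc h - i)) =
          q_int (Suc l) * (\<Prod>i<l. q_int (h - i)) + qX ^ Suc l * (\<Prod>i<k. q_int (h - i))"
        unfolding sh unfolding Suc by (simp add: algebra_simps)
      moreover have "(\<Prod>i=1..k. q_int i) dvd q_int (Suc l) * (\<Prod>i<l. q_int (h - i))"
        unfolding Suc using mult_dvd_mono[OF dvd_refl Suc.IH[of l], of "q_int (Suc l)"]
        by (simp add: mult.commute)
      moreover have "(\<Prod>i=1..k. q_int i) dvd qX ^ Suc l * (\<Prod>i<k. q_int (h - i))"
        by (rule dvd_mult[OF Suc.IH])
      ultimately show ?thesis by simp
    next
      case False
      then have z: "(\<Prod>i<l. q_int (h - i)) = 0"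
        by (intro prod_zero) (auto simp: q_int_eq_sum intro!: bexI[of _ h])
      show ?thesis unfolding sh z by simp
    qed
  qed simp
qed

lemma q_binom_mult: "(\<Prod>i=1..k. q_int i) * q_binom h k = (\<Prod>i<k. q_int (h - i))"
  unfolding q_binom_def using q_binom_dvd by (rule dvd_mult_div_cancel)


section \<open>Delannoy numbers\<close>

text \<open>A lattice path starting at the origin is given by its list of steps.\<close>

definition delannoy_paths :: "nat \<Rightarrow> nat \<Rightarrow> (nat \<times> nat) list set" where
  "delannoy_paths a c =
     {ss. set ss \<subseteq> {(1, 0), (0, 1), (1, 1)} \<and> sum_list (map fst ss) = a \<and> sum_list (map snd ss) = c}"

definition delannoy :: "nat \<Rightarrow> nat \<Rightarrow> nat" where
  "delannoy a c = card (delannoy_paths a c)"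

lemma finite_delannoy_paths: "finite (delannoy_paths a c)"
proof -
  have len: "length ss \<le> sum_list (map fst ss) + sum_list (map snd ss)"
    if "set ss \<subseteq> {(1, 0), (0, 1), (1, 1)}" for ss :: "(nat \<times> nat) list"
    using that by (induction ss) auto
  have "delannoy_paths a c \<subseteq> {ss. set ss \<subseteq> {(1, 0), (0, 1), (1, 1)} \<and> length ss \<le> a + c}"
    using len by (auto simp: delannoy_paths_def)
  then show ?thesis
    by (rule finite_subset) (rule finite_lists_length_le, simp)
qed

end

theory Submission
  imports Defs
begin

text \<open>
  By the \<open>q\<close>-binomial theorems, \<open>\<Sum>h. D_q(h, k) x^h = (\<Prod>i=1..k. 1 + q^i x) / (\<Prod>i=0..k. 1 - q^i x)\<close>.
  If \<open>q\<close> is a primitive \<open>n\<close>-th root of unity, raising \<open>k\<close> to \<open>k + n\<close> multiplies this series by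
  \<open>(1 - (- x)^n) / (1 - x^n)\<close>. For \<open>k < n\<close> its denominator divides \<open>1 - x^n\<close> with a quotient that
  keeps the degree of the numerator below \<open>n\<close>, so its coefficients are \<open>n\<close>-periodic in \<open>h\<close>.
  Hence, if \<open>n\<close> is odd, the values of \<open>D_q\<close> at \<open>q\<close> obey the recurrence of the Delannoy numbers in
  steps of \<open>n\<close>, with constant boundary values \<open>D_q(b, d)\<close>; if \<open>n\<close> is even, they are also
  \<open>n\<close>-periodic in \<open>k\<close>.
\<close>

section \<open>Delannoy numbers\<close>

lemma delannoy_paths_0_0: "delannoy_paths 0 0 = {[]}"
proof -
  have "ss = []" if "ss \<in> delannoy_paths 0 0" for ss
    using that by (cases ss) (auto simp: delannoy_paths_def)
  then show ?thesis by (auto simp: delannoy_paths_def)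
qed

lemma delannoy_paths_rec:
  assumes "a + c > 0"
  shows "delannoy_paths a c =
    (if a > 0 then (#) (1, 0) ` delannoy_paths (a - 1) c else {}) \<union>
    (if c > 0 then (#) (0, 1) ` delannoy_paths a (c - 1) else {}) \<union>
    (if a > 0 \<and> c > 0 then (#) (1, 1) ` delannoy_paths (a - 1) (c - 1) else {})" (is "_ = ?R")
proof (intro equalityI subsetI)
  fix ss assume ss: "ss \<in> delannoy_paths a c"
  then obtain s t where "ss = s # t"
    using assms by (cases ss) (auto simp: delannoy_paths_def)
  then show "ss \<in> ?R"
    using ss by (auto simp: delannoy_paths_def image_iff simp del: sum_list_eq_0_iff)
qed (auto simp: delannoy_paths_def split: if_splits)

lemma delannoy_0_left: "delannoy 0 c = 1"
proof (induction c)
  case (Suc c)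
  then show ?case by (simp add: delannoy_def delannoy_paths_rec[of 0 "Suc c"] card_image)
qed (simp add: delannoy_def delannoy_paths_0_0)

lemma delannoy_0_right: "delannoy a 0 = 1"
proof (induction a)
  case (Suc a)
  then show ?case by (simp add: delannoy_def delannoy_paths_rec[of "Suc a" 0] card_image)
qed (simp add: delannoy_0_left)

lemma delannoy_Suc_Suc:
  "delannoy (Suc a) (Suc c) = delannoy a (Suc c) + delannoy (Suc a) c + delannoy a c"
proof -
  let ?E = "(#) (1, 0) ` delannoy_paths a (Suc c)"
  let ?N = "(#) (0, 1) ` delannoy_paths (Suc a) c"
  let ?D = "(#) (1, 1) ` delannoy_paths a c"
  have "delannoy_paths (Suc a) (Suc c) = ?E \<union> ?N \<union> ?D"
    by (simp add: delannoy_paths_rec)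
  moreover have "card (?E \<union> ?N \<union> ?D) = card (?E \<union> ?N) + card ?D"
    by (rule card_Un_disjoint) (auto simp: finite_delannoy_paths)
  moreover have "card (?E \<union> ?N) = card ?E + card ?N"
    by (rule card_Un_disjoint) (auto simp: finite_delannoy_paths)
  ultimately show ?thesis by (simp add: delannoy_def card_image)
qed

lemma delannoy_recurrence_unique:
  fixes f :: "nat \<Rightarrow> nat \<Rightarrow> 'a :: comm_semiring_1"
  assumes left: "\<And>c. f 0 c = u" and right: "\<And>a. f a 0 = u"
    and rec: "\<And>a c. f (Suc a) (Suc c) = f a (Suc c) + f (Suc a) c + f a c"
  shows "f a c = of_nat (delannoy a c) * u"
proof (induction c arbitrary: a)
  case 0
  show ?case by (simp add: right delannoy_0_right)
next
  case (Suc c)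
  show ?case
    by (induction a) (simp_all add: left rec Suc delannoy_0_left delannoy_Suc_Suc algebra_simps)
qed

section \<open>Gaussian binomial coefficients\<close>

lemma q_binom_0_right: "q_binom h 0 = 1"
  by (simp add: q_binom_def)

lemma q_binom_eq_0:
  assumes "h < k"
  shows "q_binom h k = 0"
proof -
  have "(\<Prod>i<k. q_int (h - i)) = 0"
    using assms by (intro prod_zero) (auto simp: q_int_eq_sum intro!: bexI[of _ h])
  then show ?thesis by (simp only: q_binom_def div_0)
qed

lemma q_binom_Suc_Suc_if_q_int_Suc:
  assumes split: "q_int (Suc h) = u * q_int (Suc k) + v * q_int (h - k)"
  shows "q_binom (Suc h) (Suc k) = u * q_binom h k + v * q_binom h (Suc k)"
proof -
  let ?M = "\<Prod>i=1..Suc k. q_int i"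
  let ?N = "\<Prod>i<k. q_int (h - i)"
  have prod_mult_q_binom: "?M * q_binom h k = q_int (Suc k) * ?N"
    by (simp add: mult_ac flip: q_binom_mult)
  have "?M * (u * q_binom h k + v * q_binom h (Suc k)) =
      u * (?M * q_binom h k) + v * (?M * q_binom h (Suc k))"
    by (simp only: distrib_left mult.left_commute)
  also have "\<dots> = u * (q_int (Suc k) * ?N) + v * (?N * q_int (h - k))"
    by (simp only: prod_mult_q_binom q_binom_mult prod.lessThan_Suc)
  also have "\<dots> = q_int (Suc h) * ?N"
    unfolding split by (simp add: algebra_simps)
  also have "\<dots> = (\<Prod>i<Suc k. q_int (Suc h - i))"
    by (simp add: prod.lessThan_Suc_shift del: prod.lessThan_Suc)
  also have "\<dots> = ?M * q_binom (Suc h) (Suc k)"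
    by (simp only: q_binom_mult)
  finally have "?M * q_binom (Suc h) (Suc k) = ?M * (u * q_binom h k + v * q_binom h (Suc k))" ..
  moreover have "?M \<noteq> 0" by (simp add: q_int_nonzero)
  ultimately show ?thesis by (metis mult_left_cancel)
qed

lemma q_binom_Suc_Suc:
  "q_binom (Suc h) (Suc k) = q_binom h k + qX ^ Suc k * q_binom h (Suc k)"
proof (cases "k \<le> h")
  case True
  then have "q_int (Suc h) = 1 * q_int (Suc k) + qX ^ Suc k * q_int (h - k)"
    using q_int_add[of "Suc k" "h - k"] by simp
  then show ?thesis by (metis q_binom_Suc_Suc_if_q_int_Suc mult_1)
qed (simp add: q_binom_eq_0)

lemma q_binom_Suc_Suc':
  assumes "k \<le> h"
  shows "q_binom (Suc h) (Suc k) = qX ^ (h - k) * q_binom h k + q_binom h (Suc k)"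
proof -
  have "q_int (Suc h) = qX ^ (h - k) * q_int (Suc k) + 1 * q_int (h - k)"
    using q_int_add[of "h - k" "Suc k"] assms by simp
  then show ?thesis by (metis q_binom_Suc_Suc_if_q_int_Suc mult_1)
qed

section \<open>The \<open>q\<close>-Pochhammer polynomial and the \<open>q\<close>-binomial theorems\<close>

definition q_pochhammer_poly :: "'a \<Rightarrow> 'a \<Rightarrow> nat \<Rightarrow> 'a :: comm_ring_1 poly" where
  "q_pochhammer_poly s q m = (\<Prod>i<m. [:1, - (s * q ^ i):])"

lemma q_pochhammer_poly_0 [simp]: "q_pochhammer_poly s q 0 = 1"
  by (simp add: q_pochhammer_poly_def)

lemma q_pochhammer_poly_Suc:
  "q_pochhammer_poly s q (Suc m) = q_pochhammer_poly s q m * [:1, - (s * q ^ m):]"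
  unfolding q_pochhammer_poly_def by (rule prod.lessThan_Suc)

lemma q_pochhammer_poly_add:
  "q_pochhammer_poly s q (m + k) = q_pochhammer_poly s q m * q_pochhammer_poly (s * q ^ m) q k"
proof (induction k)
  case (Suc k)
  show ?case
    unfolding add_Suc_right q_pochhammer_poly_Suc Suc
    by (simp add: power_add mult_ac del: mult_pCons_right)
qed simp

lemma degree_q_pochhammer_poly_le: "degree (q_pochhammer_poly s q m) \<le> m"
proof (induction m)
  case (Suc m)
  have "degree (q_pochhammer_poly s q (Suc m)) \<le>
      degree (q_pochhammer_poly s q m) + degree [:1, - (s * q ^ m):]"
    unfolding q_pochhammer_poly_Suc by (rule degree_mult_le)
  also have "\<dots> \<le> m + 1" by (intro add_mono Suc) simp
  finally show ?case by simp
qed simp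

lemma poly_q_pochhammer_poly: "poly (q_pochhammer_poly s q m) x = (\<Prod>i<m. 1 - s * q ^ i * x)"
  by (simp add: q_pochhammer_poly_def poly_prod algebra_simps)

lemma q_pochhammer_poly_nonzero: "q_pochhammer_poly s q m \<noteq> 0"
proof
  assume "q_pochhammer_poly s q m = 0"
  then have "poly (q_pochhammer_poly s q m) 0 = 0" by simp
  then show False by (simp add: poly_q_pochhammer_poly)
qed

theorem q_binomial_theorem:
  "coeff (q_pochhammer_poly s qX k) j = (- s) ^ j * qX ^ (j choose 2) * q_binom k j"
proof (induction k arbitrary: j)
  case 0
  show ?case by (cases j) (simp_all add: q_binom_0_right q_binom_eq_0 binomial_eq_0)
next
  case (Suc k)
  show ?case
  proof (cases j)
    case 0
    then show ?thesis using Suc[of 0] by (simp add: q_pochhammer_poly_Suc q_binom_0_right)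
  next
    case j: (Suc i)
    have choose_2_Suc: "Suc i choose 2 = (i choose 2) + i" by (simp add: numeral_2_eq_2)
    have "coeff (q_pochhammer_poly s qX (Suc k)) (Suc i) =
        (- s) ^ Suc i * qX ^ (Suc i choose 2) * q_binom k (Suc i) +
        (- s) ^ Suc i * qX ^ (i choose 2) * (qX ^ k * q_binom k i)"
      using Suc[of i] Suc[of "Suc i"] by (simp add: q_pochhammer_poly_Suc algebra_simps)
    also have "\<dots> = (- s) ^ Suc i * qX ^ (Suc i choose 2) * q_binom (Suc k) (Suc i)"
    proof (cases "i \<le> k")
      case True
      then have "qX ^ k = qX ^ i * qX ^ (k - i)" by (simp flip: power_add)
      then show ?thesis
        unfolding q_binom_Suc_Suc'[OF True] choose_2_Suc by (simp add: power_add algebra_simps)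
    qed (simp add: q_binom_eq_0)
    finally show ?thesis by (simp add: j)
  qed
qed

lemma fps_mult_one_minus_monom_nth:
  "(F * fps_of_poly (1 - monom u n)) $ h = F $ h - (if h < n then 0 else u * F $ (h - n))"
  for F :: "'a :: comm_ring_1 fps"
proof -
  have "F * fps_of_poly (1 - monom u n) = F - fps_const u * (F * fps_X ^ n)"
    by (simp add: fps_of_poly_diff fps_of_poly_monom algebra_simps)
  then show ?thesis by (simp add: fps_X_power_mult_right_nth)
qed

lemma fps_mult_linear_nth:
  "(F * fps_of_poly [:1, - u:]) $ h = F $ h - (if h = 0 then 0 else u * F $ (h - 1))"
  for F :: "'a :: comm_ring_1 fps"
proof -
  have "[:1, - u:] = 1 - monom u 1" by (simp add: monom_Suc monom_0 one_pCons)
  then show ?thesis using fps_mult_one_minus_monom_nth[of F u 1 h] by simp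
qed

theorem q_binomial_theorem_negative:
  "Abs_fps (\<lambda>m. s ^ m * q_binom (m + k) k) * fps_of_poly (q_pochhammer_poly s qX (Suc k)) = 1"
proof (induction k)
  case 0
  show ?case
  proof (rule fps_ext)
    fix m
    show "(Abs_fps (\<lambda>m. s ^ m * q_binom (m + 0) 0) *
        fps_of_poly (q_pochhammer_poly s qX (Suc 0))) $ m = 1 $ m"
      by (cases m)
        (simp_all add: q_pochhammer_poly_Suc fps_mult_linear_nth q_binom_0_right)
  qed
next
  case (Suc k)
  let ?F = "\<lambda>k. Abs_fps (\<lambda>m. s ^ m * q_binom (m + k) k)"
  let ?P = "fps_of_poly (q_pochhammer_poly s qX (Suc k))"
  let ?L = "fps_of_poly [:1, - (s * qX ^ Suc k):]"
  have shift: "?F (Suc k) * ?L = ?F k"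
  proof (rule fps_ext)
    fix m
    show "(?F (Suc k) * ?L) $ m = ?F k $ m"
      using q_binom_Suc_Suc[of "m + k" k]
      by (cases m) (simp_all add: fps_mult_linear_nth q_binom_eq_0 algebra_simps)
  qed
  have "?F (Suc k) * fps_of_poly (q_pochhammer_poly s qX (Suc (Suc k))) = ?F (Suc k) * ?L * ?P"
    unfolding q_pochhammer_poly_Suc[of _ _ "Suc k"] fps_of_poly_mult by (simp only: mult_ac)
  also have "\<dots> = 1" by (simp only: shift Suc)
  finally show ?case .
qed

definition q_delannoy_fps :: "nat \<Rightarrow> int poly fps" where
  "q_delannoy_fps k = Abs_fps (\<lambda>h. q_delannoy h k)"

theorem q_delannoy_fps_mult:
  "q_delannoy_fps k * fps_of_poly (q_pochhammer_poly 1 qX (Suc k)) =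
     fps_of_poly (q_pochhammer_poly (- qX) qX k)"
proof -
  have "q_delannoy_fps k =
      fps_of_poly (q_pochhammer_poly (- qX) qX k) * Abs_fps (\<lambda>m. 1 ^ m * q_binom (m + k) k)"
  proof (rule fps_ext)
    fix h
    have "qX ^ (Suc j choose 2) = qX ^ j * qX ^ (j choose 2)" for j
      by (simp add: numeral_2_eq_2 flip: power_add)
    moreover have "h + k - j = h - j + k" if "j \<le> h" for j using that by simp
    ultimately show "q_delannoy_fps k $ h =
        (fps_of_poly (q_pochhammer_poly (- qX) qX k) * Abs_fps (\<lambda>m. 1 ^ m * q_binom (m + k) k)) $ h"
      by (auto simp: q_delannoy_fps_def q_delannoy_def fps_mult_nth q_binomial_theorem
          intro!: sum.cong)
  qed
  then show ?thesis by (simp only: mult.assoc q_binomial_theorem_negative mult_1_right)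
qed

section \<open>Evaluation at complex numbers\<close>

definition int_poly_eval :: "complex \<Rightarrow> int poly \<Rightarrow> complex" where
  "int_poly_eval z p = poly (map_poly of_int p) z"

lemma int_poly_eval_simps [simp]:
  "int_poly_eval z 0 = 0"
  "int_poly_eval z 1 = 1"
  "int_poly_eval z qX = z"
  "int_poly_eval z (p + q) = int_poly_eval z p + int_poly_eval z q"
  "int_poly_eval z (p - q) = int_poly_eval z p - int_poly_eval z q"
  "int_poly_eval z (p * q) = int_poly_eval z p * int_poly_eval z q"
  by (simp_all add: int_poly_eval_def of_int_poly_add of_int_poly_diff of_int_poly_mult qX_def
      map_poly_pCons)

lemma int_poly_eval_uminus [simp]: "int_poly_eval z (- p) = - int_poly_eval z p"
  using int_poly_eval_simps(5)[of z 0 p] by simp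

lemma int_poly_eval_power [simp]: "int_poly_eval z (p ^ m) = int_poly_eval z p ^ m"
  by (induction m) simp_all

lemma int_poly_eval_of_nat [simp]: "int_poly_eval z (of_nat m) = of_nat m"
  by (induction m) simp_all

lemma int_poly_eval_sum [simp]: "int_poly_eval z (sum f A) = (\<Sum>x\<in>A. int_poly_eval z (f x))"
  by (induction A rule: infinite_finite_induct) simp_all

lemma int_poly_eq_0_if_roots:
  assumes roots: "\<And>z. z \<in> A \<Longrightarrow> int_poly_eval z p = 0" and deg: "degree p < card A"
  shows "p = 0"
proof (rule ccontr)
  let ?p = "map_poly (of_int :: int \<Rightarrow> complex) p"
  assume "p \<noteq> 0"
  then have nonzero: "?p \<noteq> 0" using of_int_poly_inj[of p 0] by auto
  have "card A \<le> card {z. poly ?p z = 0}"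
    using roots by (intro card_mono poly_roots_finite[OF nonzero]) (auto simp: int_poly_eval_def)
  also have "\<dots> \<le> degree p"
    using card_poly_roots_bound[OF nonzero] by (simp add: of_int_poly_degree)
  finally show False using deg by simp
qed

definition int_poly_fps_eval :: "complex \<Rightarrow> int poly fps \<Rightarrow> complex fps" where
  "int_poly_fps_eval z F = Abs_fps (\<lambda>i. int_poly_eval z (F $ i))"

lemma int_poly_fps_eval_nth [simp]: "int_poly_fps_eval z F $ i = int_poly_eval z (F $ i)"
  by (simp add: int_poly_fps_eval_def)

lemma int_poly_fps_eval_mult:
  "int_poly_fps_eval z (F * G) = int_poly_fps_eval z F * int_poly_fps_eval z G"
  by (rule fps_ext) (simp add: fps_mult_nth)

lemma int_poly_fps_eval_q_pochhammer_poly: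
  "int_poly_fps_eval z (fps_of_poly (q_pochhammer_poly s qX k)) =
     fps_of_poly (q_pochhammer_poly (int_poly_eval z s) z k)"
proof (induction k)
  case 0
  show ?case by (rule fps_ext) simp
next
  case (Suc k)
  have "int_poly_fps_eval z (fps_of_poly [:1, - (s * qX ^ k):]) =
      fps_of_poly [:1, - (int_poly_eval z s * z ^ k):]"
    by (rule fps_ext) (simp add: coeff_pCons split: nat.split)
  then show ?case
    by (simp only: q_pochhammer_poly_Suc fps_of_poly_mult int_poly_fps_eval_mult Suc)
qed

lemma int_poly_fps_eval_q_delannoy_fps_mult:
  "int_poly_fps_eval z (q_delannoy_fps k) * fps_of_poly (q_pochhammer_poly 1 z (Suc k)) =
     fps_of_poly (q_pochhammer_poly (- z) z k)"
  using arg_cong[OF q_delannoy_fps_mult[of k], of "int_poly_fps_eval z"]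
  by (simp add: int_poly_fps_eval_mult int_poly_fps_eval_q_pochhammer_poly)

section \<open>Cyclotomic polynomials\<close>

lemma int_poly_eval_cyclotomic_poly:
  assumes "n > 0" "z \<in> primitive_roots n"
  shows "int_poly_eval z (cyclotomic_poly n) = 0"
  using assms finite_primitive_roots[OF assms(1)]
  by (auto simp: int_poly_eval_def cyclotomic_poly_spec poly_prod)

lemma degree_cyclotomic_poly:
  assumes "n > 0"
  shows "degree (cyclotomic_poly n) = card (primitive_roots n)"
  using degree_prod_linear[OF finite_primitive_roots[OF assms]]
  by (simp flip: cyclotomic_poly_spec[OF assms] add: of_int_poly_degree)

lemma lead_coeff_cyclotomic_poly:
  assumes "n > 0"
  shows "lead_coeff (cyclotomic_poly n) = 1"
proof -
  have "of_int (lead_coeff (cyclotomic_poly n)) = (1 :: complex)"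
    using lead_coeff_prod_linear[of "primitive_roots n"]
    by (simp flip: cyclotomic_poly_spec[OF assms] add: of_int_poly_degree coeff_map_poly)
  then show ?thesis by simp
qed

lemma cyclotomic_poly_dvdI:
  assumes "n > 0" and root: "\<And>z. z \<in> primitive_roots n \<Longrightarrow> int_poly_eval z p = 0"
  shows "cyclotomic_poly n dvd p"
proof -
  let ?C = "cyclotomic_poly n"
  have nonzero: "?C \<noteq> 0" using lead_coeff_cyclotomic_poly[OF assms(1)] by auto
  obtain S R where division: "pseudo_divmod p ?C = (S, R)" by fastforce
  have p_eq: "p = ?C * S + R" and remainder: "R = 0 \<or> degree R < degree ?C"
    using pseudo_divmod[OF nonzero division] lead_coeff_cyclotomic_poly[OF assms(1)] by auto
  have "int_poly_eval z R = 0" if "z \<in> primitive_roots n" for z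
    using root[OF that] int_poly_eval_cyclotomic_poly[OF assms(1) that] by (simp add: p_eq)
  then have "R = 0"
    using remainder int_poly_eq_0_if_roots degree_cyclotomic_poly[OF assms(1)] by metis
  then show ?thesis using p_eq by simp
qed

section \<open>Values at primitive roots of unity\<close>

lemma primitive_root_power_eq_1: "z \<in> primitive_roots n \<Longrightarrow> z ^ n = 1"
  by (simp add: primitive_roots_def)

lemma inj_on_power_primitive_root:
  assumes z: "z \<in> primitive_roots n"
  shows "inj_on (\<lambda>i. z ^ i) {..<n}"
proof (rule linorder_inj_onI')
  fix i j assume ij: "i \<in> {..<n}" "j \<in> {..<n}" "i < j"
  have "z \<noteq> 0" using primitive_root_power_eq_1[OF z] ij by (auto simp: power_0_left)
  then have "z ^ (j - i) = 1" if "z ^ i = z ^ j"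
    using that ij by (simp add: power_diff)
  then show "z ^ i \<noteq> z ^ j"
    using z ij by (auto simp: primitive_roots_def)
qed

lemma bij_betw_power_primitive_root:
  assumes "n > 0" and z: "z \<in> primitive_roots n"
  shows "bij_betw (\<lambda>i. z ^ i) {..<n} {w. w ^ n = 1}"
proof (rule bij_betw_imageI[OF inj_on_power_primitive_root[OF z]])
  have "(z ^ i) ^ n = 1" for i
    using primitive_root_power_eq_1[OF z] by (metis mult.commute power_mult power_one)
  then show "(\<lambda>i. z ^ i) ` {..<n} = {w. w ^ n = 1}"
    using assms(1) card_image[OF inj_on_power_primitive_root[OF z]]
    by (intro card_subset_eq) (auto simp: finite_roots_unity card_roots_unity_eq)
qed

lemma prod_diff_power_primitive_root:
  assumes "n > 0" and z: "z \<in> primitive_roots n"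
  shows "(\<Prod>i<n. y - z ^ i) = y ^ n - 1"
proof -
  have "(\<Prod>i<n. y - z ^ i) = (\<Prod>w | w ^ n = 1. y - w)"
    using bij_betw_power_primitive_root[OF assms] by (rule prod.reindex_bij_betw)
  also have "\<dots> = poly (\<Prod>w | w ^ n = 1. [:- w, 1:]) y"
    by (simp add: poly_prod)
  also have "\<dots> = y ^ n - 1"
    by (simp add: roots_unity_factorization[OF assms(1)] poly_monom)
  finally show ?thesis .
qed

lemma q_pochhammer_poly_primitive_root:
  assumes "n > 0" and z: "z \<in> primitive_roots n"
  shows "q_pochhammer_poly s z n = 1 - monom (s ^ n) n"
proof -
  have prod_eq: "(\<Prod>i<n. 1 - z ^ i * t) = 1 - t ^ n" for t
  proof (cases "t = 0")
    case False
    then have "(\<Prod>i<n. 1 - z ^ i * t) = (\<Prod>i<n. t * (1 / t - z ^ i))"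
      by (simp add: algebra_simps)
    also have "\<dots> = t ^ n * ((1 / t) ^ n - 1)"
      by (simp add: prod.distrib prod_diff_power_primitive_root[OF assms])
    finally show ?thesis using False by (simp add: right_diff_distrib power_one_over)
  qed (use assms(1) in simp)
  have "poly (q_pochhammer_poly s z n) x = poly (1 - monom (s ^ n) n) x" for x
    using prod_eq[of "s * x"] by (simp add: poly_q_pochhammer_poly poly_monom power_mult_distrib mult_ac)
  then show ?thesis by (simp add: poly_eq_poly_eq_iff[symmetric] fun_eq_iff)
qed

lemma q_pochhammer_poly_add_order:
  assumes "n > 0" and z: "z \<in> primitive_roots n"
  shows "q_pochhammer_poly s z (k + n) = (1 - monom (s ^ n) n) * q_pochhammer_poly s z k"
  using q_pochhammer_poly_add[of s z n k]
  by (simp add: q_pochhammer_poly_primitive_root[OF assms] primitive_root_power_eq_1[OF z] add.commute)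

lemma q_delannoy_fps_primitive_root_add_order:
  assumes "n > 0" and z: "z \<in> primitive_roots n"
  shows "int_poly_fps_eval z (q_delannoy_fps (k + n)) * fps_of_poly (1 - monom 1 n) =
    int_poly_fps_eval z (q_delannoy_fps k) * fps_of_poly (1 - monom ((- 1) ^ n) n)"
    (is "?F' * ?A = ?F * ?B")
proof -
  let ?P = "fps_of_poly (q_pochhammer_poly 1 z (Suc k))"
  have sign: "(- z) ^ n = (- 1) ^ n"
    by (simp add: power_minus[of z] primitive_root_power_eq_1[OF z])
  have "?F' * ?A * ?P = ?F' * fps_of_poly (q_pochhammer_poly 1 z (Suc (k + n)))"
    using q_pochhammer_poly_add_order[OF assms, of 1 "Suc k"]
    by (simp add: fps_of_poly_mult mult.assoc)
  also have "\<dots> = fps_of_poly (q_pochhammer_poly (- z) z (k + n))"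
    by (rule int_poly_fps_eval_q_delannoy_fps_mult)
  also have "\<dots> = ?B * fps_of_poly (q_pochhammer_poly (- z) z k)"
    by (simp only: q_pochhammer_poly_add_order[OF assms] sign fps_of_poly_mult)
  also have "\<dots> = ?F * ?B * ?P"
    by (simp flip: int_poly_fps_eval_q_delannoy_fps_mult add: mult_ac)
  finally have "?F' * ?A * ?P = ?F * ?B * ?P" .
  moreover have "?P \<noteq> 0"
    using q_pochhammer_poly_nonzero fps_of_poly_eq_iff[of _ 0] by (metis fps_of_poly_0)
  ultimately show ?thesis by (metis mult_right_cancel)
qed

lemma q_delannoy_primitive_root_rec:
  assumes "n > 0" "z \<in> primitive_roots n"
  shows "int_poly_eval z (q_delannoy (h + n) (k + n)) =
    int_poly_eval z (q_delannoy h (k + n)) + int_poly_eval z (q_delannoy (h + n) k) -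
    (- 1) ^ n * int_poly_eval z (q_delannoy h k)"
  using arg_cong[OF q_delannoy_fps_primitive_root_add_order[OF assms, of k], of "\<lambda>F. F $ (h + n)"]
  by (simp add: fps_mult_one_minus_monom_nth q_delannoy_fps_def) (simp add: algebra_simps)

lemma q_delannoy_primitive_root_add_order_right:
  assumes "z \<in> primitive_roots n" "h < n"
  shows "int_poly_eval z (q_delannoy h (k + n)) = int_poly_eval z (q_delannoy h k)"
  using arg_cong[OF q_delannoy_fps_primitive_root_add_order[of n z k], of "\<lambda>F. F $ h"] assms
  by (simp add: fps_mult_one_minus_monom_nth q_delannoy_fps_def)

lemma q_delannoy_primitive_root_add_order_left:
  assumes z: "z \<in> primitive_roots n" and "k < n"
  shows "int_poly_eval z (q_delannoy (h + n) k) = int_poly_eval z (q_delannoy h k)"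
proof -
  have n: "n > 0" using assms by simp
  define W where "W = q_pochhammer_poly (z ^ Suc k) z (n - Suc k)"
  let ?F = "int_poly_fps_eval z (q_delannoy_fps k)"
  have "1 - monom 1 n = q_pochhammer_poly 1 z (Suc k) * W"
    using q_pochhammer_poly_add[of 1 z "Suc k" "n - Suc k"] \<open>k < n\<close>
      q_pochhammer_poly_primitive_root[OF n z, of 1]
    by (simp add: W_def)
  then have "?F * fps_of_poly (1 - monom 1 n) =
      ?F * fps_of_poly (q_pochhammer_poly 1 z (Suc k)) * fps_of_poly W"
    by (simp only: fps_of_poly_mult mult.assoc)
  also have "\<dots> = fps_of_poly (q_pochhammer_poly (- z) z k * W)"
    by (simp only: int_poly_fps_eval_q_delannoy_fps_mult fps_of_poly_mult)
  finally have "(?F * fps_of_poly (1 - monom 1 n)) $ (h + n) =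
      coeff (q_pochhammer_poly (- z) z k * W) (h + n)"
    by simp
  moreover have "degree (q_pochhammer_poly (- z) z k * W) \<le> k + (n - Suc k)"
    unfolding W_def
    by (rule order_trans[OF degree_mult_le]) (intro add_mono degree_q_pochhammer_poly_le)
  then have "coeff (q_pochhammer_poly (- z) z k * W) (h + n) = 0"
    using \<open>k < n\<close> by (intro coeff_eq_0) linarith
  ultimately show ?thesis
    by (simp add: fps_mult_one_minus_monom_nth q_delannoy_fps_def)
qed

lemma q_delannoy_primitive_root_mult_add_left:
  assumes "z \<in> primitive_roots n" "k < n"
  shows "int_poly_eval z (q_delannoy (a * n + b) k) = int_poly_eval z (q_delannoy b k)"
proof (induction a)
  case (Suc a)
  then show ?case
    using q_delannoy_primitive_root_add_order_left[OF assms, of "a * n + b"] by (simp add: add_ac)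
qed simp

lemma q_delannoy_primitive_root_mult_add_right:
  assumes "z \<in> primitive_roots n" "h < n"
  shows "int_poly_eval z (q_delannoy h (c * n + d)) = int_poly_eval z (q_delannoy h d)"
proof (induction c)
  case (Suc c)
  then show ?case
    using q_delannoy_primitive_root_add_order_right[OF assms, of "c * n + d"] by (simp add: add_ac)
qed simp

theorem q_delannoy_odd_primitive_root:
  assumes z: "z \<in> primitive_roots n" and "odd n" "b < n" "d < n"
  shows "int_poly_eval z (q_delannoy (a * n + b) (c * n + d)) =
    of_nat (delannoy a c) * int_poly_eval z (q_delannoy b d)"
proof (rule delannoy_recurrence_unique)
  fix a c
  show "int_poly_eval z (q_delannoy (0 * n + b) (c * n + d)) = int_poly_eval z (q_delannoy b d)"
    using q_delannoy_primitive_root_mult_add_right[OF z \<open>b < n\<close>] by simp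
  show "int_poly_eval z (q_delannoy (a * n + b) (0 * n + d)) = int_poly_eval z (q_delannoy b d)"
    using q_delannoy_primitive_root_mult_add_left[OF z \<open>d < n\<close>] by simp
  have "n > 0" using \<open>odd n\<close> by (rule odd_pos)
  then show "int_poly_eval z (q_delannoy (Suc a * n + b) (Suc c * n + d)) =
      int_poly_eval z (q_delannoy (a * n + b) (Suc c * n + d)) +
      int_poly_eval z (q_delannoy (Suc a * n + b) (c * n + d)) +
      int_poly_eval z (q_delannoy (a * n + b) (c * n + d))"
    using q_delannoy_primitive_root_rec[OF _ z, of "a * n + b" "c * n + d"] \<open>odd n\<close>
    by (simp add: add_ac)
qed

theorem q_delannoy_even_primitive_root:
  assumes z: "z \<in> primitive_roots n" and "even n" "d < n"
  shows "int_poly_eval z (q_delannoy (a * n + b) (c * n + d)) = int_poly_eval z (q_delannoy b d)"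
proof -
  have n: "n > 0" using assms by simp
  have "fps_of_poly (1 - monom 1 n :: complex poly) $ 0 \<noteq> 0" using n by simp
  then have nonzero: "fps_of_poly (1 - monom 1 n :: complex poly) \<noteq> 0" by (metis fps_zero_nth)
  have "int_poly_fps_eval z (q_delannoy_fps (c * n + d)) = int_poly_fps_eval z (q_delannoy_fps d)"
  proof (induction c)
    case (Suc c)
    then show ?case
      using q_delannoy_fps_primitive_root_add_order[OF n z, of "c * n + d"] \<open>even n\<close> nonzero
      by (simp add: add_ac)
  qed simp
  then have "int_poly_eval z (q_delannoy h (c * n + d)) = int_poly_eval z (q_delannoy h d)" for h
    by (simp add: fps_eq_iff q_delannoy_fps_def)
  then show ?thesis
    using q_delannoy_primitive_root_mult_add_left[OF z \<open>d < n\<close>] by simp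
qed

theorem theorem1p1:
  fixes n a b c d :: nat
  assumes "n \<ge> 1" and "b \<le> n - 1" and "d \<le> n - 1"
  shows "(odd n \<longrightarrow> cyclotomic_poly n dvd
            (q_delannoy (a * n + b) (c * n + d) - of_nat (delannoy a c) * q_delannoy b d)) \<and>
         (even n \<longrightarrow> cyclotomic_poly n dvd
            (q_delannoy (a * n + b) (c * n + d) - q_delannoy b d))"
proof -
  have n: "n > 0" "b < n" "d < n" using assms by auto
  show ?thesis
  proof (intro conjI impI cyclotomic_poly_dvdI[OF \<open>n > 0\<close>])
    fix z assume z: "z \<in> primitive_roots n"
    show "int_poly_eval z (q_delannoy (a * n + b) (c * n + d) -
        of_nat (delannoy a c) * q_delannoy b d) = 0" if "odd n"
      using q_delannoy_odd_primitive_root[OF z that \<open>b < n\<close> \<open>d < n\<close>] by simp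
    show "int_poly_eval z (q_delannoy (a * n + b) (c * n + d) - q_delannoy b d) = 0" if "even n"
      using q_delannoy_even_primitive_root[OF z that \<open>d < n\<close>] by simp
  qed
qed

end
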